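(* Let $A$ be a von Neumann regular ring containing $\mathbb{Q}$ (as a subring). Then the polynomial ring $A[X]$ is an SP-ring.
   Context: All rings are commutative with $1$. A regular element is a non-zerodivisor, and a regular ideal is an ideal containing a regular element. An ideal $I$ is radical if $\sqrt{I}=I$ (the whole ring counts as a radical ideal). An SP-ring is a ring in which every regular ideal is a (finite) product of radical ideals. A ring $A$ is von Neumann regular if for every $a\in A$ there is $b\in A$ with $a=a^2b$. *)

theory Defs
  imports Complex_Main "HOL-Computational_Algebra.Polynomial"
begin

text \<open>
  A commutative ring is a type of class \<open>comm_ring_1\<close>, regarded as a module over itself;
  its ideals are the submodules. The class excludes the zero ring, which does not contain the
  rationals.
\<close>

global_interpretation self_module: module "(*) :: 'r::comm_ring_1 \<Rightarrow> 'r \<Rightarrow> 'r"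
  by unfold_locales (simp_all add: algebra_simps)

definition ideal :: "'r::comm_ring_1 set \<Rightarrow> bool" where
  "ideal I \<longleftrightarrow> self_module.subspace I"

definition ideal_mult :: "'r::comm_ring_1 set \<Rightarrow> 'r set \<Rightarrow> 'r set" where
  "ideal_mult I J = self_module.span {a * b |a b. a \<in> I \<and> b \<in> J}"

definition ideal_prod_list :: "'r::comm_ring_1 set list \<Rightarrow> 'r set" where
  "ideal_prod_list Js = foldr ideal_mult Js UNIV"

definition radical :: "'r::comm_ring_1 set \<Rightarrow> 'r set" where
  "radical I = {x. \<exists>n>0. x ^ n \<in> I}"

definition radical_ideal :: "'r::comm_ring_1 set \<Rightarrow> bool" where
  "radical_ideal I \<longleftrightarrow> ideal I \<and> radical I = I"

definition regular_element :: "'r::comm_ring_1 \<Rightarrow> bool" where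
  "regular_element x \<longleftrightarrow> (\<forall>y. x * y = 0 \<longrightarrow> y = 0)"

definition regular_ideal :: "'r::comm_ring_1 set \<Rightarrow> bool" where
  "regular_ideal I \<longleftrightarrow> ideal I \<and> (\<exists>x\<in>I. regular_element x)"

definition sp_ring :: "'r::comm_ring_1 itself \<Rightarrow> bool" where
  "sp_ring _ \<longleftrightarrow>
    (\<forall>I::'r set. regular_ideal I \<longrightarrow>
      (\<exists>Js. (\<forall>J\<in>set Js. radical_ideal J) \<and> I = ideal_prod_list Js))"

definition von_neumann_regular :: "'r::comm_ring_1 itself \<Rightarrow> bool" where
  "von_neumann_regular _ \<longleftrightarrow> (\<forall>a::'r. \<exists>b. a = a\<^sup>2 * b)"

definition contains_rationals :: "'r::comm_ring_1 itself \<Rightarrow> bool" where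
  "contains_rationals _ \<longleftrightarrow>
    (\<exists>h :: rat \<Rightarrow> 'r. inj h \<and> h 1 = 1 \<and>
      (\<forall>x y. h (x + y) = h x + h y) \<and> (\<forall>x y. h (x * y) = h x * h y))"

end

theory Submission imports Defs begin

text \<open>
  Over a field of characteristic zero a nonzero ideal of polynomials is generated by some
  \<open>q = h\<^sub>1 * h\<^sub>2 * \<dots> * h\<^sub>n\<close> with all \<open>h\<^sub>i\<close> squarefree and each \<open>h\<^sub>i\<^sub>+\<^sub>1\<close> dividing \<open>h\<^sub>i\<close>.
  Here \<open>h\<^sub>1\<close> generates the radical of \<open>(q)\<close>, and \<open>h\<^sub>2 * \<dots> * h\<^sub>n\<close> is the greatest common divisor
  of \<open>q\<close> and its derivative. In terms of ideals, with \<open>D I\<close> denoting the ideal generated by \<open>I\<close>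
  and the derivatives of its elements, this reads \<open>I = radical I * D I\<close>. The proof
  establishes that identity for every regular ideal \<open>I\<close> of \<open>A[X]\<close>
  (\<open>regular_ideal_eq_radical_mult_deriv_ideal\<close>) and iterates it. If \<open>f\<close> is a regular element of
  \<open>I\<close>, then after \<open>degree f\<close> steps the remaining factor contains \<open>f\<close> and all its derivatives, which
  generate the unit ideal (\<open>higher_derivs_generate_unit_ideal\<close>), so only radicals are left.

  The argument runs over \<open>A\<close> itself instead of its residue fields. Two polynomials have a
  greatest common divisor with Bezout coefficients (\<open>bezout_pair_poly\<close>):
  an idempotent splits \<open>A\<close> into a part where a given leading coefficient is a unit and a part where
  it vanishes, and Euclid's algorithm runs on both. Hence any element of \<open>I\<close> is a
  multiple of a regular, thus cancellable, element of \<open>I\<close>. The two statements on the orders of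
  vanishing of \<open>q\<close> and of its derivative that a factorization into primes would
  give are proved as divisibilities: \<open>regular_dvd_power_if_dvd_deriv\<close>, which uses that positive
  integers are invertible, and \<open>regular_dvd_mult_deriv_if_dvd_power\<close>.
\<close>

(* For a ring acting on itself, this rule is reversed associativity of multiplication and loops
   together with the rules for associative and commutative rewriting. *)
declare self_module.scale_scale [simp del]


section \<open>Formal derivatives over rings with zero divisors\<close>

definition formal_deriv :: "'a::comm_ring_1 poly \<Rightarrow> 'a poly" where
  "formal_deriv p = Abs_poly (\<lambda>n. of_nat (Suc n) * coeff p (Suc n))"

lemma coeff_formal_deriv: "coeff (formal_deriv p) n = of_nat (Suc n) * coeff p (Suc n)"
  unfolding formal_deriv_def
  by (subst coeff_Abs_poly[of "degree p"]) (auto simp: coeff_eq_0)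

lemma formal_deriv_0 [simp]: "formal_deriv 0 = 0"
  by (rule poly_eqI) (simp add: coeff_formal_deriv)

lemma formal_deriv_add: "formal_deriv (p + q) = formal_deriv p + formal_deriv q"
  by (rule poly_eqI) (simp add: coeff_formal_deriv algebra_simps)

lemma formal_deriv_smult: "formal_deriv (smult a p) = smult a (formal_deriv p)"
  by (rule poly_eqI) (simp add: coeff_formal_deriv algebra_simps)

lemma formal_deriv_pCons: "formal_deriv (pCons a p) = p + pCons 0 (formal_deriv p)"
  by (rule poly_eqI)
    (simp add: coeff_formal_deriv coeff_pCons algebra_simps split: nat.split)

lemma formal_deriv_mult: "formal_deriv (p * q) = formal_deriv p * q + p * formal_deriv q"
proof (induction p)
  case (pCons a p)
  then show ?case
    by (simp add: formal_deriv_add formal_deriv_smult formal_deriv_pCons algebra_simps)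
qed simp

text \<open>
  The factor \<open>m\<close> is the product of the integers from \<open>n + 1\<close> to \<open>n + k\<close>; since it is positive, it is
  a unit in a ring that contains the rationals.
\<close>
lemma coeff_formal_deriv_funpow:
  "\<exists>m>0. coeff ((formal_deriv ^^ k) p) n = of_nat m * coeff p (n + k)"
proof (induction k arbitrary: n)
  case 0
  show ?case by (rule exI[of _ 1]) simp
next
  case (Suc k)
  obtain m where m: "m > 0"
    "coeff ((formal_deriv ^^ k) p) (Suc n) = of_nat m * coeff p (Suc n + k)"
    using Suc.IH by blast
  have "coeff ((formal_deriv ^^ Suc k) p) n = of_nat (Suc n * m) * coeff p (n + Suc k)"
    using m(2) by (simp add: coeff_formal_deriv algebra_simps)
  then show ?case using m(1) by (intro exI[of _ "Suc n * m"]) simp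
qed


section \<open>Ideals and regular elements\<close>

lemma ideal_iff:
  "ideal I \<longleftrightarrow> 0 \<in> I \<and> (\<forall>x\<in>I. \<forall>y\<in>I. x + y \<in> I) \<and> (\<forall>c. \<forall>x\<in>I. c * x \<in> I)"
  by (simp add: ideal_def self_module.subspace_def)

lemma ideal_0: "ideal I \<Longrightarrow> 0 \<in> I"
  and ideal_add: "ideal I \<Longrightarrow> x \<in> I \<Longrightarrow> y \<in> I \<Longrightarrow> x + y \<in> I"
  and ideal_mult_left: "ideal I \<Longrightarrow> x \<in> I \<Longrightarrow> c * x \<in> I"
  by (simp_all add: ideal_iff)

lemma ideal_diff: "ideal I \<Longrightarrow> x \<in> I \<Longrightarrow> y \<in> I \<Longrightarrow> x - y \<in> I"
  by (simp add: ideal_def self_module.subspace_diff)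

lemma ideal_dvd: "ideal I \<Longrightarrow> x \<in> I \<Longrightarrow> x dvd y \<Longrightarrow> y \<in> I"
  by (metis dvd_def ideal_mult_left mult.commute)

lemma ideal_sum: "ideal I \<Longrightarrow> (\<And>i. i \<in> S \<Longrightarrow> f i \<in> I) \<Longrightarrow> sum f S \<in> I"
  by (simp add: ideal_def self_module.subspace_sum)

lemma ideal_ideal_mult: "ideal (ideal_mult I J)"
  by (simp add: ideal_def ideal_mult_def)

lemma mult_in_ideal_mult: "a \<in> I \<Longrightarrow> b \<in> J \<Longrightarrow> a * b \<in> ideal_mult I J"
  unfolding ideal_mult_def by (rule self_module.span_base) blast

lemma ideal_mult_subset:
  assumes "ideal K" and "\<And>a b. a \<in> I \<Longrightarrow> b \<in> J \<Longrightarrow> a * b \<in> K"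
  shows "ideal_mult I J \<subseteq> K"
  unfolding ideal_mult_def using assms
  by (intro self_module.span_minimal) (auto simp: ideal_def)

text \<open>
  In the binomial expansion of \<open>(x + y) ^ (m + n)\<close> every term contains \<open>x ^ m\<close> or \<open>y ^ n\<close>.
\<close>
lemma ideal_radical:
  assumes "ideal I"
  shows "ideal (radical I)"
proof -
  have "x + y \<in> radical I" if x: "x \<in> radical I" and y: "y \<in> radical I" for x y
  proof -
    obtain m n where mn: "m > 0" "x ^ m \<in> I" "n > 0" "y ^ n \<in> I"
      using x y by (auto simp: radical_def)
    have "of_nat (m + n choose k) * x ^ k * y ^ (m + n - k) \<in> I" for k
    proof (cases "m \<le> k")
      case True
      then show ?thesis
        by (intro ideal_dvd[OF assms mn(2)] dvd_mult2 dvd_mult le_imp_power_dvd)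
    next
      case False
      then show ?thesis
        by (intro ideal_dvd[OF assms mn(4)] dvd_mult le_imp_power_dvd) simp
    qed
    then have "(x + y) ^ (m + n) \<in> I"
      using assms by (simp only: binomial_ring ideal_sum)
    then show ?thesis using mn(1) unfolding radical_def by (intro CollectI exI[of _ "m + n"]) simp
  qed
  moreover have "c * x \<in> radical I" if "x \<in> radical I" for c x
    using that assms by (auto simp: radical_def power_mult_distrib intro: ideal_mult_left)
  moreover have "0 \<in> radical I"
    using assms unfolding radical_def by (auto intro!: exI[of _ 1] ideal_0)
  ultimately show ?thesis by (simp add: ideal_iff)
qed

lemma radical_ideal_radical:
  fixes I :: "'a::comm_ring_1 set"
  assumes "ideal I"
  shows "radical_ideal (radical I)"
proof -
  have "radical (radical I) \<subseteq> radical I"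
    by (auto simp: radical_def power_mult[symmetric]) (metis nat_0_less_mult_iff)
  moreover have "J \<subseteq> radical J" for J :: "'a set"
    unfolding radical_def by (auto intro!: exI[of _ 1])
  ultimately show ?thesis
    using assms by (auto simp: radical_ideal_def ideal_radical)
qed

lemma regular_cancel:
  assumes "regular_element c" and "c * x = c * y"
  shows "x = y"
proof -
  have "c * (x - y) = 0" using assms(2) by (simp add: algebra_simps)
  then have "x - y = 0" using assms(1) unfolding regular_element_def by blast
  then show ?thesis by simp
qed

lemma regular_dvd_cancel:
  assumes "regular_element c" and "c * x dvd c * y"
  shows "x dvd y"
proof -
  obtain z where "c * y = c * x * z" using assms(2) by (elim dvdE)
  then have "c * y = c * (x * z)" by (simp only: mult.assoc)
  then have "y = x * z" by (rule regular_cancel[OF assms(1)])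
  then show ?thesis by simp
qed

lemma regular_if_dvd_regular:
  assumes "regular_element q" and "c dvd q"
  shows "regular_element c"
  unfolding regular_element_def
proof (intro allI impI)
  fix y assume "c * y = 0"
  moreover obtain z where "q = c * z" using assms(2) by (elim dvdE)
  ultimately have "q * y = 0" by (metis mult.assoc mult.commute mult_zero_left)
  then show "y = 0" using assms(1) by (simp add: regular_element_def)
qed


section \<open>Greatest common divisors over a von Neumann regular ring\<close>

text \<open>
  A Bezout pair generates a principal ideal \<open>(d)\<close>. Asking the cofactors \<open>r\<close>, \<open>s\<close> to
  generate the unit ideal gives \<open>d = u * f + v * g\<close>, and keeps the cofactors coprime
  even where \<open>d\<close> is a zero divisor.
\<close>
definition bezout_pair :: "'r::comm_ring_1 \<Rightarrow> 'r \<Rightarrow> bool" where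
  "bezout_pair f g \<longleftrightarrow>
    (\<exists>d r s u v. f = d * r \<and> g = d * s \<and> u * r + v * s = 1)"

lemma bezout_pair_sym: "bezout_pair f g \<Longrightarrow> bezout_pair g f"
  unfolding bezout_pair_def by (metis add.commute)

lemma bezout_pair_0: "bezout_pair 0 g"
  unfolding bezout_pair_def
  by (rule exI[of _ g], rule exI[of _ 0], rule exI[of _ 1], rule exI[of _ 0], rule exI[of _ 1]) simp

lemma bezout_pair_euclid_step:
  assumes "bezout_pair f (g - h * f)"
  shows "bezout_pair f g"
proof -
  obtain d r s u v where *: "f = d * r" "g - h * f = d * s" "u * r + v * s = 1"
    using assms unfolding bezout_pair_def by blast
  have "g = d * (s + h * r)" using * by (simp add: algebra_simps)
  moreover have "(u - v * h) * r + v * (s + h * r) = 1" using *(3) by (simp add: algebra_simps)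
  ultimately show ?thesis using *(1) unfolding bezout_pair_def by blast
qed

text \<open>
  An idempotent \<open>e\<close> splits the ring into the factors cut out by \<open>e\<close> and \<open>1 - e\<close>,
  and an equational property may be checked in each factor.
\<close>
lemma bezout_pair_glue:
  fixes e :: "'r::comm_ring_1"
  assumes e: "e * e = e"
    and "bezout_pair (e * f) (e * g)" and "bezout_pair ((1 - e) * f) ((1 - e) * g)"
  shows "bezout_pair f g"
proof -
  obtain d r s u v where 1: "e * f = d * r" "e * g = d * s" "u * r + v * s = 1"
    using assms(2) unfolding bezout_pair_def by blast
  obtain d' r' s' u' v' where 2: "(1 - e) * f = d' * r'" "(1 - e) * g = d' * s'"
    "u' * r' + v' * s' = 1"
    using assms(3) unfolding bezout_pair_def by blast
  define k where "k = 1 - e"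
  have k: "k * k = k" "e * k = 0" "e + k = 1" using e by (simp_all add: k_def algebra_simps)
  have glue: "(e * x + k * x') * (e * y + k * y') = e * (x * y) + k * (x' * y')" for x y x' y'
  proof -
    have "(e * x + k * x') * (e * y + k * y')
        = (e * e) * (x * y) + (k * k) * (x' * y') + (e * k) * (x * y' + x' * y)"
      by (simp add: algebra_simps)
    then show ?thesis by (simp add: e k)
  qed
  have rebuild: "e * (e * x) + k * (k * x) = x" for x
    using e k by (simp add: mult.assoc[symmetric] distrib_right[symmetric])
  have "f = (e * d + k * d') * (e * r + k * r')"
    unfolding glue using rebuild[of f] 1(1) 2(1) by (simp add: k_def)
  moreover have "g = (e * d + k * d') * (e * s + k * s')"
    unfolding glue using rebuild[of g] 1(2) 2(2) by (simp add: k_def)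
  moreover have "(e * u + k * u') * (e * r + k * r') + (e * v + k * v') * (e * s + k * s') = 1"
  proof -
    have "(e * u + k * u') * (e * r + k * r') + (e * v + k * v') * (e * s + k * s')
        = e * (u * r + v * s) + k * (u' * r' + v' * s')"
      unfolding glue by (simp add: algebra_simps)
    then show ?thesis using 1(3) 2(3) k(3) by simp
  qed
  ultimately show ?thesis unfolding bezout_pair_def by blast
qed

lemma von_neumann_regular_idempotent:
  fixes a :: "'a::comm_ring_1"
  assumes "von_neumann_regular TYPE('a)"
  obtains b where "(a * b) * (a * b) = a * b" and "(a * b) * a = a"
proof -
  obtain b where b: "a = a\<^sup>2 * b" using assms unfolding von_neumann_regular_def by blast
  then have 1: "(a * b) * a = a" by (simp add: power2_eq_square ac_simps)
  then have "(a * b) * (a * b) = a * b" by (metis mult.assoc)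
  then show ?thesis using 1 that by blast
qed

text \<open>
  Euclid's algorithm. Where the leading coefficient of \<open>f\<close> is invertible, a division step
  lowers the degree of \<open>g\<close>; on the complementary factor that coefficient vanishes, so the
  degree of \<open>f\<close> drops. Measuring \<open>f\<close> by the length of its coefficient list instead of its
  degree places the zero polynomial below the constants.
\<close>
lemma bezout_pair_poly:
  fixes f g :: "'a::comm_ring_1 poly"
  assumes vnr: "von_neumann_regular TYPE('a)"
  shows "bezout_pair f g"
proof (induction "length (coeffs f) + length (coeffs g)" arbitrary: f g rule: less_induct)
  case less
  have len: "length (coeffs p) \<le> n \<longleftrightarrow> (\<forall>i\<ge>n. coeff p i = 0)" for p :: "'a poly" and n
  proof
    assume "length (coeffs p) \<le> n"
    then show "\<forall>i\<ge>n. coeff p i = 0"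
      by (cases "p = 0") (auto simp: length_coeffs_degree intro!: coeff_eq_0)
  next
    assume *: "\<forall>i\<ge>n. coeff p i = 0"
    show "length (coeffs p) \<le> n"
    proof (cases "p = 0")
      case False
      then have "\<not> n \<le> degree p" using * leading_coeff_0_iff by blast
      then show ?thesis using False by (simp add: length_coeffs_degree)
    qed simp
  qed
  have ordered: "bezout_pair f g"
    if IH: "\<And>f' g' :: 'a poly.
        length (coeffs f') + length (coeffs g') < length (coeffs f) + length (coeffs g)
          \<Longrightarrow> bezout_pair f' g'"
      and fg: "f \<noteq> 0" "g \<noteq> 0" "degree f \<le> degree g"
    for f g :: "'a poly"
  proof -
    define m n a c where "m = degree f" and "n = degree g" and "a = coeff f m" and "c = coeff g n"
    obtain b where b: "(a * b) * (a * b) = a * b" "(a * b) * a = a"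
      using von_neumann_regular_idempotent[OF vnr] by blast
    define e where "e = [:a * b:]"
    have e: "e * e = e" using b by (simp add: e_def)
    have lf: "length (coeffs f) = Suc m" and lg: "length (coeffs g) = Suc n"
      using fg by (simp_all add: length_coeffs_degree m_def n_def)
    have high: "coeff f i = 0" if "i > m" for i
      using that by (simp add: m_def coeff_eq_0)
    have high': "coeff g i = 0" if "i > n" for i
      using that by (simp add: n_def coeff_eq_0)
    (* Multiplication by a * b fixes a, so h * (e * f) has leading term a * b * c at degree n,
       the same as e * g. *)
    define h where "h = monom (b * c) (n - m)"
    have mn: "m \<le> n" using fg by (simp add: m_def n_def)
    have "bezout_pair (e * f) (e * g - h * (e * f))"
    proof (rule IH)
      have "length (coeffs (e * f)) \<le> Suc m"
        unfolding len by (auto simp: e_def high)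
      moreover have "length (coeffs (e * g - h * (e * f))) \<le> n"
        unfolding len
      proof (intro allI impI)
        fix i assume i: "n \<le> i"
        show "coeff (e * g - h * (e * f)) i = 0"
        proof (cases "i = n")
          case True
          have "a * b * c - b * c * ((a * b) * a) = 0"
            using b(2) by (simp add: algebra_simps)
          then show ?thesis
            using True mn by (simp add: e_def h_def coeff_monom_mult a_def c_def)
        next
          case False
          then show ?thesis
            using i mn by (simp add: e_def h_def coeff_monom_mult high high')
        qed
      qed
      ultimately show "length (coeffs (e * f)) + length (coeffs (e * g - h * (e * f)))
          < length (coeffs f) + length (coeffs g)"
        using lf lg by linarith
    qed
    then have 1: "bezout_pair (e * f) (e * g)" by (rule bezout_pair_euclid_step)
    have compl: "1 - e = [:1 - a * b:]" by (simp add: e_def one_pCons)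
    have "bezout_pair ((1 - e) * f) ((1 - e) * g)"
    proof (rule IH)
      have "length (coeffs ((1 - e) * f)) \<le> m"
        unfolding len
      proof (intro allI impI)
        fix i assume "m \<le> i"
        then show "coeff ((1 - e) * f) i = 0"
          using b(2) by (cases "i = m") (simp_all add: compl high a_def left_diff_distrib)
      qed
      moreover have "length (coeffs ((1 - e) * g)) \<le> Suc n"
        unfolding len by (auto simp: compl high')
      ultimately show "length (coeffs ((1 - e) * f)) + length (coeffs ((1 - e) * g))
          < length (coeffs f) + length (coeffs g)"
        using lf lg by linarith
    qed
    with e 1 show ?thesis by (rule bezout_pair_glue)
  qed
  consider "f = 0" | "g = 0" | "f \<noteq> 0" "g \<noteq> 0" "degree f \<le> degree g"
    | "f \<noteq> 0" "g \<noteq> 0" "degree g \<le> degree f" by linarith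
  then show ?case
  proof cases
    case 1 then show ?thesis by (simp add: bezout_pair_0)
  next
    case 2 then show ?thesis by (simp add: bezout_pair_0 bezout_pair_sym)
  next
    case 3 show ?thesis by (rule ordered[OF less 3])
  next
    case 4
    have "bezout_pair g f" by (rule ordered[OF less 4(2,1,3)]) simp
    then show ?thesis by (rule bezout_pair_sym)
  qed
qed

lemma common_divisor_in_ideal:
  fixes f g :: "'a::comm_ring_1 poly"
  assumes "von_neumann_regular TYPE('a)" and "ideal I" and "f \<in> I" and "g \<in> I"
  obtains q where "q \<in> I" and "q dvd f" and "q dvd g"
proof -
  obtain d r s u v where *: "f = d * r" "g = d * s" "u * r + v * s = 1"
    using bezout_pair_poly[OF assms(1), of f g] unfolding bezout_pair_def by blast
  have "d = d * (u * r + v * s)" using *(3) by simp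
  also have "\<dots> = u * f + v * g" using *(1,2) by (simp add: algebra_simps)
  finally have "d \<in> I" using assms(2-4) by (simp add: ideal_add ideal_mult_left)
  then show ?thesis using that *(1,2) by simp
qed


section \<open>Higher derivatives of a regular polynomial\<close>

lemma contains_rationals_of_nat_unit:
  assumes "contains_rationals TYPE('a::comm_ring_1)" and "n > 0"
  shows "(of_nat n :: 'a) dvd 1"
proof -
  obtain h :: "rat \<Rightarrow> 'a" where h: "h 1 = 1" "\<And>x y. h (x + y) = h x + h y"
    "\<And>x y. h (x * y) = h x * h y"
    using assms(1) unfolding contains_rationals_def by blast
  have h0: "h 0 = 0" using h(2)[of 0 0] by simp
  have "h (of_nat k) = of_nat k" for k
    by (induction k) (simp_all add: h0 h)
  moreover have "h (of_nat n) * h (1 / of_nat n) = 1"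
    using assms(2) h(1) by (simp add: h(3)[symmetric])
  ultimately show ?thesis by (metis dvd_triv_left)
qed

text \<open>
  The ideal contains the constant \<open>k! * coeff d k\<close>, hence \<open>coeff d k\<close>, up to the terms of
  higher degree in the \<open>k\<close>-th derivative, whose coefficients are multiples of
  later coefficients of \<open>d\<close>; so all coefficients belong to it, from the top down. An
  idempotent of the ideal acts as the identity on finitely many of its constants, here
  on all coefficients of \<open>d\<close>, and by regularity it is \<open>1\<close>.
\<close>
lemma higher_derivs_generate_unit_ideal:
  fixes d :: "'a::comm_ring_1 poly"
  assumes vnr: "von_neumann_regular TYPE('a)" and rat: "contains_rationals TYPE('a)"
    and d: "regular_element d" and J: "ideal J"
    and derivs: "\<And>k. k \<le> degree d \<Longrightarrow> (formal_deriv ^^ k) d \<in> J"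
  shows "1 \<in> J"
proof -
  have const: "[:coeff d k:] \<in> J" for k
  proof (induction "degree d - k" arbitrary: k rule: less_induct)
    case less
    show ?case
    proof (cases "k \<le> degree d")
      case False
      then show ?thesis using J by (simp add: coeff_eq_0 ideal_0)
    next
      case True
      define p where "p = (formal_deriv ^^ k) d"
      have "p \<in> J" using derivs True by (simp add: p_def)
      have later: "[:coeff d i:] \<in> J" if "i > k" for i
      proof (cases "i \<le> degree d")
        case True
        then show ?thesis using that less[of i] by simp
      next
        case False
        then show ?thesis using J by (simp add: coeff_eq_0 ideal_0)
      qed
      have tail: "monom (coeff p i) i \<in> J" if "i > 0" for i
      proof -
        obtain m where m: "coeff p i = of_nat m * coeff d (i + k)"
          using coeff_formal_deriv_funpow[of k d i] unfolding p_def by blast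
        have "monom (coeff p i) i = monom (of_nat m) i * [:coeff d (i + k):]"
          by (simp add: m mult_monom flip: monom_0)
        moreover have "[:coeff d (i + k):] \<in> J" using that by (intro later) simp
        ultimately show ?thesis using J by (simp only: ideal_mult_left)
      qed
      have "p = (\<Sum>i\<le>degree p. monom (coeff p i) i)"
        by (rule poly_as_sum_of_monoms[symmetric])
      also have "\<dots> = monom (coeff p 0) 0 + (\<Sum>i\<in>{..degree p} - {0}. monom (coeff p i) i)"
        by (rule sum.remove) simp_all
      finally have "[:coeff p 0:] = p - (\<Sum>i\<in>{..degree p} - {0}. monom (coeff p i) i)"
        by (simp add: monom_0 algebra_simps)
      also have "\<dots> \<in> J"
        using J \<open>p \<in> J\<close> tail by (intro ideal_diff ideal_sum) auto
      finally have p0: "[:coeff p 0:] \<in> J" .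
      obtain m where m: "m > 0" "coeff p 0 = of_nat m * coeff d k"
        using coeff_formal_deriv_funpow[of k d 0] unfolding p_def by auto
      obtain z :: 'a where "1 = of_nat m * z"
        using contains_rationals_of_nat_unit[OF rat m(1)] by (elim dvdE)
      then have "z * coeff p 0 = coeff d k"
        using m(2) by (metis mult.assoc mult.commute mult_1_left)
      then have "[:coeff d k:] = [:z:] * [:coeff p 0:]" by (simp add: mult.commute)
      then show ?thesis using J p0 by (simp only: ideal_mult_left)
    qed
  qed
  have "\<exists>e. e * e = e \<and> [:e:] \<in> J \<and> (\<forall>i<n. e * coeff d i = coeff d i)" for n
  proof (induction n)
    case 0
    show ?case using J by (intro exI[of _ 0]) (simp add: ideal_0)
  next
    case (Suc n)
    then obtain e where e: "e * e = e" "[:e:] \<in> J" "\<And>i. i < n \<Longrightarrow> e * coeff d i = coeff d i"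
      by blast
    define a where "a = coeff d n"
    obtain b where b: "(a * b) * (a * b) = a * b" "(a * b) * a = a"
      using von_neumann_regular_idempotent[OF vnr] by blast
    define e' where "e' = a * b"
    have e': "e' * e' = e'" "e' * a = a" using b by (simp_all add: e'_def)
    have "[:e':] = [:b:] * [:a:]" by (simp add: e'_def mult.commute)
    then have e'J: "[:e':] \<in> J" using J const[of n] by (simp only: a_def ideal_mult_left)
    \<comment> \<open>The join of the two idempotents fixes whatever either of them fixes.\<close>
    define j where "j = e + e' - e * e'"
    have "j * x = x" if "e * x = x \<or> e' * x = x" for x
      using that by (auto simp: j_def algebra_simps mult.assoc) (metis mult.left_commute)+
    moreover have "j * j = j"
    proof -
      have "j * j = e * e + 2 * e * e' + e' * e' - 2 * (e * e) * e' - 2 * e * (e' * e')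
          + (e * e) * (e' * e')"
        by (simp add: j_def algebra_simps)
      then show ?thesis by (simp add: e e' j_def)
    qed
    moreover have "[:j:] = [:e:] + [:e':] - [:e:] * [:e':]" by (simp add: j_def)
    then have "[:j:] \<in> J" using J e(2) e'J by (simp only: ideal_add ideal_diff ideal_mult_left)
    ultimately show ?case
      using e(3) e'(2) by (intro exI[of _ j]) (auto simp: less_Suc_eq a_def)
  qed
  then obtain e where e: "[:e:] \<in> J" "\<And>i. i < Suc (degree d) \<Longrightarrow> e * coeff d i = coeff d i"
    by blast
  have "d * (1 - [:e:]) = d - smult e d" by (simp add: algebra_simps)
  also have "smult e d = d"
  proof (rule poly_eqI)
    show "coeff (smult e d) i = coeff d i" for i
      using e(2)[of i] by (cases "i \<le> degree d") (simp_all add: coeff_eq_0)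
  qed
  finally have "1 - [:e:] = 0" using d unfolding regular_element_def diff_self by blast
  then show ?thesis using e(1) by simp
qed

text \<open>
  Let \<open>D\<close> denote differentiation. Differentiating \<open>r ^ k * (D ^^ k) d\<close>, a multiple of \<open>d\<close>, and
  multiplying by \<open>r\<close> shows by induction that \<open>d\<close> divides this product for all \<open>k\<close>; as the derivatives of \<open>d\<close> generate the unit ideal,
  a power of \<open>r\<close> is divisible by \<open>d\<close>. Over a field of characteristic zero the hypothesis expresses that every prime
  factor of \<open>d\<close> divides \<open>r\<close>.
\<close>
lemma regular_dvd_power_if_dvd_deriv:
  fixes d r :: "'a::comm_ring_1 poly"
  assumes vnr: "von_neumann_regular TYPE('a)" and rat: "contains_rationals TYPE('a)"
    and d: "regular_element d" and dr: "d dvd r * formal_deriv d"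
  shows "d dvd r ^ degree d"
proof -
  have derivs: "d dvd r ^ k * (formal_deriv ^^ k) d" for k
  proof (induction k)
    case (Suc k)
    define p where "p = (formal_deriv ^^ k) d"
    obtain t where t: "r ^ k * p = d * t" using Suc by (auto simp: p_def elim: dvdE)
    have "r * formal_deriv (r ^ k * p) = (r * formal_deriv d) * t + d * (r * formal_deriv t)"
      unfolding t formal_deriv_mult by (simp add: algebra_simps)
    then have 1: "d dvd r * formal_deriv (r ^ k * p)" using dr by simp
    have 2: "d dvd r * (formal_deriv (r ^ k) * p)"
    proof (cases k)
      case 0
      have "formal_deriv (1 :: 'a poly) = 0"
        by (simp add: one_pCons formal_deriv_pCons)
      then show ?thesis using 0 by simp
    next
      case (Suc l)
      have "r ^ Suc l dvd r * formal_deriv (r ^ Suc l)"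
      proof (induction l)
        case (Suc l)
        have "r * formal_deriv (r ^ Suc (Suc l))
            = (r * r ^ Suc l) * formal_deriv r + r * (r * formal_deriv (r ^ Suc l))"
          unfolding power_Suc[of r "Suc l"] formal_deriv_mult
          by (simp only: distrib_left mult.assoc mult.commute mult.left_commute)
        moreover have "r * r ^ Suc l dvd r * (r * formal_deriv (r ^ Suc l))"
          using Suc by (rule mult_dvd_mono[OF dvd_refl])
        ultimately show ?case by simp
      qed simp
      then have "r ^ k * p dvd r * formal_deriv (r ^ k) * p"
        using Suc by (intro mult_dvd_mono) simp_all
      then show ?thesis using t by (metis dvd_mult_left mult.assoc)
    qed
    have "r ^ Suc k * (formal_deriv ^^ Suc k) d
        = r * formal_deriv (r ^ k * p) - r * (formal_deriv (r ^ k) * p)"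
      by (simp add: formal_deriv_mult p_def algebra_simps)
    then show ?case using 1 2 by (simp add: dvd_diff)
  qed simp
  have "1 \<in> {x. d dvd r ^ degree d * x}"
  proof (rule higher_derivs_generate_unit_ideal[OF vnr rat d])
    show "ideal {x. d dvd r ^ degree d * x}"
      by (auto simp: ideal_iff distrib_left mult.left_commute)
    fix k assume "k \<le> degree d"
    then have "r ^ k dvd r ^ degree d" by (rule le_imp_power_dvd)
    then have "r ^ k * (formal_deriv ^^ k) d dvd r ^ degree d * (formal_deriv ^^ k) d"
      by (rule mult_dvd_mono) simp
    then show "(formal_deriv ^^ k) d \<in> {x. d dvd r ^ degree d * x}"
      using derivs[of k] dvd_trans by blast
  qed
  then show ?thesis by simp
qed

text \<open>
  A derivative lowers the order of vanishing by at most one, and \<open>p\<close> makes up for it. Cancelling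
  the common divisor \<open>c\<close> of \<open>q\<close> and \<open>p\<close> leaves the same situation with \<open>q / c\<close> dividing
  a smaller power of \<open>c\<close>.
\<close>
lemma regular_dvd_mult_deriv_if_dvd_power:
  fixes q p :: "'a::comm_ring_1 poly"
  assumes vnr: "von_neumann_regular TYPE('a)"
  shows "regular_element q \<Longrightarrow> q dvd p ^ n \<Longrightarrow> q dvd p * formal_deriv q"
proof (induction n arbitrary: p q)
  case 0
  then have "q dvd 1" by simp
  then show ?case using dvd_trans one_dvd by blast
next
  case (Suc n)
  obtain c w t \<alpha> \<beta> where *: "q = c * w" "p = c * t" "\<alpha> * w + \<beta> * t = 1"
    using bezout_pair_poly[OF vnr, of q p] unfolding bezout_pair_def by blast
  have c: "regular_element c" and w: "regular_element w"
    using Suc.prems(1) *(1) by (auto intro: regular_if_dvd_regular)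
  have coprime: "w dvd x" if "w dvd t * x" for x
  proof -
    have "x = (\<alpha> * w + \<beta> * t) * x" using *(3) by simp
    also have "\<dots> = w * (\<alpha> * x) + \<beta> * (t * x)" by (simp add: algebra_simps)
    finally show ?thesis using that by (metis dvd_add dvd_mult dvd_triv_left)
  qed
  have "c * w dvd c * (c ^ n * t ^ Suc n)"
    using Suc.prems(2) *(1,2) by (simp add: power_mult_distrib mult.assoc mult.left_commute)
  then have "w dvd t ^ Suc n * c ^ n"
    using c by (metis mult.commute regular_dvd_cancel)
  then have "w dvd t ^ k * c ^ n \<Longrightarrow> w dvd c ^ n" for k
    by (induction k) (auto simp: mult.assoc intro: coprime)
  then have "w dvd c ^ n" using \<open>w dvd t ^ Suc n * c ^ n\<close> by blast
  then have IH: "w dvd c * formal_deriv w" using Suc.IH w by blast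
  have "p * formal_deriv q = (c * w) * (t * formal_deriv c) + c * (c * formal_deriv w) * t"
    using *(1,2) by (simp add: formal_deriv_mult algebra_simps)
  moreover have "c * w dvd c * (c * formal_deriv w) * t"
    by (rule dvd_mult2[OF mult_dvd_mono[OF dvd_refl IH]])
  ultimately show ?case using *(1) by simp
qed


section \<open>Splitting off the radical of a regular ideal\<close>

text \<open>
  This set is the ideal generated by \<open>I\<close> and the derivatives of its elements, because
  \<open>p * g' = (p * g)' - p' * g\<close>.
\<close>
definition deriv_ideal :: "'a::comm_ring_1 poly set \<Rightarrow> 'a poly set" where
  "deriv_ideal I = {f + formal_deriv g |f g. f \<in> I \<and> g \<in> I}"

lemma deriv_ideal_upper:
  assumes "ideal I"
  shows "I \<subseteq> deriv_ideal I" and "g \<in> I \<Longrightarrow> formal_deriv g \<in> deriv_ideal I"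
proof -
  show "I \<subseteq> deriv_ideal I"
    using ideal_0[OF assms] unfolding deriv_ideal_def by (force intro: exI[of _ 0])
  show "g \<in> I \<Longrightarrow> formal_deriv g \<in> deriv_ideal I"
    using ideal_0[OF assms] unfolding deriv_ideal_def by (force intro: exI[of _ 0])
qed

lemma ideal_deriv_ideal:
  assumes I: "ideal I"
  shows "ideal (deriv_ideal I)"
proof -
  have "0 \<in> deriv_ideal I" using deriv_ideal_upper[OF I] ideal_0[OF I] by blast
  moreover have "x + y \<in> deriv_ideal I" if xy: "x \<in> deriv_ideal I" "y \<in> deriv_ideal I" for x y
  proof -
    obtain f g f1 g1 where "x = f + formal_deriv g" "y = f1 + formal_deriv g1"
      "f \<in> I" "g \<in> I" "f1 \<in> I" "g1 \<in> I" using xy unfolding deriv_ideal_def by blast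
    moreover from this have "x + y = (f + f1) + formal_deriv (g + g1)"
      by (simp add: formal_deriv_add)
    ultimately show ?thesis using I unfolding deriv_ideal_def by (blast intro: ideal_add)
  qed
  moreover have "p * x \<in> deriv_ideal I" if x: "x \<in> deriv_ideal I" for p x
  proof -
    obtain f g where fg: "x = f + formal_deriv g" "f \<in> I" "g \<in> I"
      using x unfolding deriv_ideal_def by blast
    have "p * x = (p * f - formal_deriv p * g) + formal_deriv (p * g)"
      by (simp add: fg(1) formal_deriv_mult algebra_simps)
    then show ?thesis
      using I fg unfolding deriv_ideal_def by (blast intro: ideal_diff ideal_mult_left)
  qed
  ultimately show ?thesis by (simp add: ideal_iff)
qed

text \<open>
  Since \<open>I\<close> contains a regular element, each of its elements is a multiple of a regular \<open>q\<close> in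
  \<open>I\<close>, and the argument becomes one about \<open>q\<close>: with \<open>d\<close> the greatest common divisor of \<open>q\<close> and
  \<open>q'\<close>, the quotient \<open>q / d\<close> lies in the radical of \<open>(q)\<close>, so \<open>q\<close> is the product of an element of
  \<open>radical I\<close> and one of \<open>deriv_ideal I\<close>. Conversely, for \<open>p ^ n\<close> and \<open>g\<close> in \<open>I\<close> a
  regular \<open>q\<close> in \<open>I\<close> divides both; it divides \<open>p * q'\<close>, hence also \<open>p * g'\<close>.
\<close>
lemma regular_ideal_eq_radical_mult_deriv_ideal:
  fixes I :: "'a::comm_ring_1 poly set"
  assumes vnr: "von_neumann_regular TYPE('a)" and rat: "contains_rationals TYPE('a)"
    and reg: "regular_ideal I"
  shows "I = ideal_mult (radical I) (deriv_ideal I)"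
proof
  obtain f where I: "ideal I" and f: "f \<in> I" "regular_element f"
    using reg unfolding regular_ideal_def by blast
  show "I \<subseteq> ideal_mult (radical I) (deriv_ideal I)"
  proof
    fix g assume "g \<in> I"
    then obtain q where q: "q \<in> I" "q dvd f" "q dvd g"
      using common_divisor_in_ideal[OF vnr I f(1)] by blast
    have q_reg: "regular_element q" using f(2) q(2) by (rule regular_if_dvd_regular)
    obtain d r s u v where *: "q = d * r" "formal_deriv q = d * s" "u * r + v * s = 1"
      using bezout_pair_poly[OF vnr, of q "formal_deriv q"] unfolding bezout_pair_def by blast
    have d: "regular_element d" using q_reg *(1) by (auto intro: regular_if_dvd_regular)
    have "r * formal_deriv d = d * (s - formal_deriv r)"
      using *(2) unfolding *(1) formal_deriv_mult by (simp add: algebra_simps)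
    then have "d dvd r ^ degree d"
      using vnr rat d by (intro regular_dvd_power_if_dvd_deriv) simp_all
    then have "q dvd r ^ Suc (degree d)"
      unfolding *(1) power_Suc by (subst mult.commute) (intro mult_dvd_mono dvd_refl)
    then have "r ^ Suc (degree d) \<in> I" using I q(1) by (blast intro: ideal_dvd)
    then have r: "r \<in> radical I" unfolding radical_def by blast
    have "d = d * (u * r + v * s)" using *(3) by simp
    also have "\<dots> = u * q + v * formal_deriv q"
      unfolding *(2) by (simp add: *(1) algebra_simps)
    also have "\<dots> \<in> deriv_ideal I"
      using deriv_ideal_upper[OF I] ideal_deriv_ideal[OF I] q(1)
      by (blast intro: ideal_add ideal_mult_left)
    finally have "r * d \<in> ideal_mult (radical I) (deriv_ideal I)"
      using r by (intro mult_in_ideal_mult)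
    then show "g \<in> ideal_mult (radical I) (deriv_ideal I)"
      using q(3) *(1) ideal_ideal_mult by (metis ideal_dvd mult.commute)
  qed
  show "ideal_mult (radical I) (deriv_ideal I) \<subseteq> I"
  proof (rule ideal_mult_subset[OF I])
    fix p x assume "p \<in> radical I" and "x \<in> deriv_ideal I"
    then obtain n a g where n: "p ^ n \<in> I" and x: "x = a + formal_deriv g" "a \<in> I" "g \<in> I"
      unfolding radical_def deriv_ideal_def by blast
    obtain q1 where q1: "q1 \<in> I" "q1 dvd f" "q1 dvd g"
      using common_divisor_in_ideal[OF vnr I f(1) x(3)] by blast
    obtain q where q: "q \<in> I" "q dvd q1" "q dvd p ^ n"
      using common_divisor_in_ideal[OF vnr I q1(1) n] by blast
    have "regular_element q" using f(2) q1(2) q(2) by (blast intro: regular_if_dvd_regular dvd_trans)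
    then have dvd: "q dvd p * formal_deriv q"
      using q(3) by (rule regular_dvd_mult_deriv_if_dvd_power[OF vnr])
    obtain s where "g = q * s" using dvd_trans[OF q(2) q1(3)] by (elim dvdE)
    then have "p * formal_deriv g = (p * formal_deriv q) * s + q * (p * formal_deriv s)"
      by (simp add: formal_deriv_mult algebra_simps)
    then have "p * formal_deriv g \<in> I" using dvd q(1) I by (auto intro: ideal_dvd)
    then show "p * x \<in> I" using I x by (simp add: distrib_left ideal_add ideal_mult_left)
  qed
qed


section \<open>Regular ideals as products of radicals\<close>

theorem corollary2p15:
  assumes "von_neumann_regular TYPE('a::comm_ring_1)"
    and "contains_rationals TYPE('a)"
  shows "sp_ring TYPE('a poly)"
  unfolding sp_ring_def
proof (intro allI impI)
  fix I :: "'a poly set"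
  assume "regular_ideal I"
  then obtain f where I: "ideal I" and f: "f \<in> I" "regular_element f"
    unfolding regular_ideal_def by blast
  (* K k contains f and its derivatives up to order k, and I is the product of the radicals of
     K 0, ..., K (k - 1) with K k. *)
  define K where "K k = (deriv_ideal ^^ k) I" for k
  define Js where "Js k = map (\<lambda>i. radical (K i)) [0..<k]" for k
  have K_Suc: "K (Suc k) = deriv_ideal (K k)" for k by (simp add: K_def)
  have K: "ideal (K k)" for k
    by (induction k) (simp_all add: K_Suc ideal_deriv_ideal, simp add: K_def I)
  have derivs: "j \<le> k \<Longrightarrow> (formal_deriv ^^ j) f \<in> K k" for j k
  proof (induction k arbitrary: j)
    case 0
    then show ?case using f by (simp add: K_def)
  next
    case (Suc k)
    then show ?case
      using deriv_ideal_upper[OF K[of k]] by (cases "j = Suc k") (auto simp: K_Suc)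
  qed
  have "I = foldr ideal_mult (Js k) (K k)" for k
  proof (induction k)
    case 0
    show ?case by (simp add: K_def Js_def)
  next
    case (Suc k)
    have "regular_ideal (K k)"
      using K f(2) derivs[of 0 k] unfolding regular_ideal_def by auto
    then have "K k = ideal_mult (radical (K k)) (K (Suc k))"
      unfolding K_Suc by (rule regular_ideal_eq_radical_mult_deriv_ideal[OF assms])
    with Suc show ?case by (simp add: Js_def)
  qed
  moreover have "1 \<in> K (degree f)"
    using assms f(2) K derivs by (rule higher_derivs_generate_unit_ideal)
  then have "K (degree f) = UNIV"
    using K[of "degree f"] ideal_dvd one_dvd by blast
  ultimately have "I = ideal_prod_list (Js (degree f))"
    by (metis ideal_prod_list_def)
  moreover have "\<forall>J\<in>set (Js (degree f)). radical_ideal J"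
    by (auto simp: Js_def K radical_ideal_radical)
  ultimately show "\<exists>Js. (\<forall>J\<in>set Js. radical_ideal J) \<and> I = ideal_prod_list Js" by blast
qed

end
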